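(* Let $x,y\in\mathbb{R}^n$ with $x^Ty\neq 0$ and let $0<u<1$. Let the roundoffs $\delta_k$, $1\leq k\leq 2n-1$, be random variables with $\mathbb{E}[\delta_k]=0$ and $|\delta_k|\leq u$. Let $\hat{s}_{2n}=\mathrm{fl}(x^Ty)$ be the computed inner product defined by $\hat{s}_1=x_1y_1$, $\hat{s}_2=\hat{s}_1(1+\delta_1)$ and, for $2\leq k\leq n$, $$\hat{s}_{2k-1}=\hat{s}_{2k-2}+x_ky_k(1+\delta_{2k-2}),\qquad \hat{s}_{2k}=\hat{s}_{2k-1}(1+\delta_{2k-1}).$$ Then for any $0<\delta<1$, with probability at least $1-\delta$, $$\left|\frac{\mathrm{fl}(x^Ty)-x^Ty}{x^Ty}\right|\leq\frac{|x|^T|y|}{|x^Ty|}\,\sqrt{2\ln(2/\delta)}\,\sqrt{\frac{u\,\gamma_{2n}}{2}},$$ where $\gamma_{2n}=(1+u)^{2n}-1$.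
   Context: The recursion models the sequential (left to right) floating point accumulation of the inner product of two fixed vectors whose elements are stored exactly, with $n$ multiplications and $n-1$ additions each incurring one roundoff; $\mathrm{fl}(x^Ty)$ is simply notation for $\hat{s}_{2n}$. $|x|=(|x_1|,\ldots,|x_n|)^T$ is the componentwise absolute value. The scalar $\delta$ (failure probability) is unrelated to the random variables $\delta_k$.
   Formalization: The roundoffs are additionally assumed mean-independent: the conditional expectation of δ_k given δ_1,…,δ_{k-1} equals E[δ_k] = 0. Without this the claim fails, e.g. n=2, x=y=(1,0), u=0.01, all δ_k equal to the same fair ±u variable, δ=0.99. *)

theory Defs
  imports "HOL-Probability.Probability"
begin

text \<open>
  Vectors in \<open>\<real>\<^sup>n\<close> are functions \<open>nat \<Rightarrow> real\<close> of which only the values at \<open>1, \<dots>, n\<close> are used,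
  and roundoffs are a family \<open>nat \<Rightarrow> 'a \<Rightarrow> real\<close> of which only the members \<open>1, \<dots>, 2 n - 1\<close> are used.
\<close>

definition inner_prod :: "nat \<Rightarrow> (nat \<Rightarrow> real) \<Rightarrow> (nat \<Rightarrow> real) \<Rightarrow> real" where
  "inner_prod n x y = (\<Sum>k=1..n. x k * y k)"

definition abs_vec :: "(nat \<Rightarrow> real) \<Rightarrow> nat \<Rightarrow> real" where
  "abs_vec x = (\<lambda>k. \<bar>x k\<bar>)"

text \<open>
  The argument \<open>d\<close> is one realisation of the roundoffs. The step to \<open>Suc (Suc m)\<close> always uses roundoff
  number \<open>Suc m\<close>: it is an addition if \<open>Suc (Suc m) = 2 k\<close> with \<open>k \<ge> 2\<close> (for \<open>k = 1\<close>, the rounding of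
  the first product), and the multiplication of \<open>x k\<close> by \<open>y k\<close>
  if \<open>Suc (Suc m) = 2 k - 1\<close>, that is, \<open>k = (m + 3) div 2\<close>. Index 0 does not occur in the recursion and
  carries a dummy value. The lemmas below are the recursion in its usual form.
\<close>

fun partial_sum :: "(nat \<Rightarrow> real) \<Rightarrow> (nat \<Rightarrow> real) \<Rightarrow> (nat \<Rightarrow> real) \<Rightarrow> nat \<Rightarrow> real" where
  "partial_sum x y d 0 = 0"
| "partial_sum x y d (Suc 0) = x 1 * y 1"
| "partial_sum x y d (Suc (Suc m)) =
    (if even m
     then partial_sum x y d (Suc m) * (1 + d (Suc m))
     else partial_sum x y d (Suc m)
            + x ((m + 3) div 2) * y ((m + 3) div 2) * (1 + d (Suc m)))"

lemma partial_sum_1: "partial_sum x y d 1 = x 1 * y 1"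
  by simp

lemma partial_sum_2: "partial_sum x y d 2 = partial_sum x y d 1 * (1 + d 1)"
  by (simp add: numeral_2_eq_2)

lemma partial_sum_odd:
  assumes "2 \<le> k"
  shows "partial_sum x y d (2 * k - 1) =
    partial_sum x y d (2 * k - 2) + x k * y k * (1 + d (2 * k - 2))"
proof -
  obtain j where j: "k = Suc (Suc j)"
    using assms by (metis Suc_le_D numeral_2_eq_2 Suc_le_mono)
  have "2 * k - 1 = Suc (Suc (2 * j + 1))" "2 * k - 2 = Suc (2 * j + 1)" "(2 * j + 1 + 3) div 2 = k"
    using j by simp_all
  then show ?thesis
    by (simp only: partial_sum.simps) simp
qed

lemma partial_sum_even:
  assumes "2 \<le> k"
  shows "partial_sum x y d (2 * k) = partial_sum x y d (2 * k - 1) * (1 + d (2 * k - 1))"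
proof -
  obtain j where j: "k = Suc j"
    using assms by (metis Suc_le_D numeral_2_eq_2)
  have "2 * k = Suc (Suc (2 * j))" "2 * k - 1 = Suc (2 * j)"
    using j by simp_all
  then show ?thesis
    by (simp only: partial_sum.simps) simp
qed

definition fl_inner_prod :: "nat \<Rightarrow> (nat \<Rightarrow> real) \<Rightarrow> (nat \<Rightarrow> real) \<Rightarrow> (nat \<Rightarrow> real) \<Rightarrow> real" where
  "fl_inner_prod n x y d = partial_sum x y d (2 * n)"

definition gamma_factor :: "real \<Rightarrow> nat \<Rightarrow> real" where
  "gamma_factor u m = (1 + u) ^ m - 1"

text \<open>The \<open>\<sigma>\<close>-algebra generated by the roundoffs \<open>\<delta> 1, \<dots>, \<delta> (k - 1)\<close>.\<close>

definition roundoff_history :: "'a measure \<Rightarrow> (nat \<Rightarrow> 'a \<Rightarrow> real) \<Rightarrow> nat \<Rightarrow> 'a measure" where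
  "roundoff_history M \<delta> k =
    sigma (space M) (\<Union>i\<in>{1..<k}. {\<delta> i -` A \<inter> space M | A. A \<in> sets borel})"

text \<open>
  Conditionally independent means: \<open>E[\<delta>\<^sub>k | \<delta>\<^sub>1, \<dots>, \<delta>\<^sub>k\<^sub>-\<^sub>1] = E[\<delta>\<^sub>k]\<close> almost surely for \<open>1 \<le> k \<le> N\<close>.
  This is weaker than mutual independence of the roundoffs. Bounded roundoffs with mean zero and no
  condition on their joint distribution do not suffice: they may all be equal, and then the error
  grows like \<open>n u\<close> and not like \<open>sqrt n u\<close>.
\<close>

definition mean_independent :: "'a measure \<Rightarrow> nat \<Rightarrow> (nat \<Rightarrow> 'a \<Rightarrow> real) \<Rightarrow> bool" where
  "mean_independent M N \<delta> \<longleftrightarrow>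
    (\<forall>k\<in>{1..N}. AE \<omega> in M.
      real_cond_exp M (roundoff_history M \<delta> k) (\<delta> k) \<omega> = prob_space.expectation M (\<delta> k))"

end

theory Submission
  imports Defs
begin

text \<open>
  The error of the computed inner product is a sum of martingale differences: it equals
  \<open>\<Sum>i. w i * \<delta> i\<close>, where the weight \<open>w i\<close> is the number to which roundoff \<open>i\<close> is applied
  (\<open>fl_inner_prod_error\<close>). The weight depends only on \<open>\<delta> 1, \<dots>, \<delta> (i - 1)\<close>, hence mean independence
  makes the conditional expectation of each term vanish. The Azuma--Hoeffding inequality
  (\<open>azuma_hoeffding\<close>) then bounds the error, outside an event of probability \<open>p\<close>, by
  \<open>sqrt (2 * ln (2 / p)) * sqrt V\<close> for every \<open>V\<close> that dominates the sum of the squares of bounds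
  on the terms.

  It remains to see that \<open>V = T\<^sup>2 * u * gamma_factor u (2 * n) / 2\<close> is admissible, where \<open>T\<close> is the
  inner product of the absolute values. Although there are \<open>2 n - 1\<close> roundoffs, only \<open>n\<close> of them act
  on a running sum, which after \<open>k\<close> components is at most \<open>T * (1 + u) ^ (k - 1)\<close>; the squares of these
  bounds, times \<open>u\<^sup>2\<close>, form a geometric sum of the required size. The other \<open>n - 1\<close> roundoffs act on single
  products, and their squares are absorbed by the gap between the square of a partial sum of absolute
  values and the next one (\<open>sum_weight_bound_squared_le\<close>).
\<close>

section \<open>The Azuma--Hoeffding inequality\<close>

text \<open>
  Hoeffding's lemma for a fair sign, whose moment generating function is \<open>cosh\<close>; the auxiliary
  inequality behind that lemma is used with success probability \<open>1 / 2\<close> and range \<open>2 x\<close>.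
\<close>

lemma cosh_le_exp_half_square: "cosh x \<le> exp (x\<^sup>2 / 2)" for x :: real
proof -
  have *: "cosh x \<le> exp (x\<^sup>2 / 2)" if "x > 0" for x :: real
  proof -
    have "ln (cosh x) = - x + ln (1 + 1 / 2 * (exp (2 * x) - 1))"
    proof -
      have "cosh x = exp (- x) * (1 + 1 / 2 * (exp (2 * x) - 1))"
        by (simp add: cosh_field_def field_simps flip: exp_add)
      moreover have "1 + 1 / 2 * (exp (2 * x) - 1) > 0"
        using exp_gt_zero[of "2 * x"] by (simp add: field_simps del: exp_gt_zero)
      ultimately show ?thesis
        by (simp add: ln_mult)
    qed
    also have "\<dots> \<le> x\<^sup>2 / 2"
      using Hoeffdings_lemma_aux[of "2 * x" "1 / 2"] that by (simp add: power_mult_distrib)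
    finally show ?thesis
      by (metis cosh_real_pos exp_le_cancel_iff exp_ln)
  qed
  show ?thesis
    using *[of x] *[of "- x"] by (cases x "0 :: real" rule: linorder_cases) auto
qed

text \<open>
  On \<open>[-1, 1]\<close> the convex function \<open>exp (a v)\<close> lies below its chord, whose slope is \<open>sinh a\<close>.
  A bound that is affine in \<open>v\<close> can be integrated knowing only the mean of \<open>v\<close>.
\<close>

lemma exp_mult_le_chord:
  fixes a v :: real
  assumes "\<bar>v\<bar> \<le> 1"
  shows "exp (a * v) \<le> cosh a + v * sinh a"
proof -
  have "exp (((1 - v) / 2) *\<^sub>R (- a) + ((1 + v) / 2) *\<^sub>R a)
      \<le> ((1 - v) / 2) * exp (- a) + ((1 + v) / 2) * exp a"
    using assms convex_onD[OF exp_convex, of "(1 + v) / 2" "- a" a]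
    by (simp add: field_simps)
  also have "((1 - v) / 2) * exp (- a) + ((1 + v) / 2) * exp a = cosh a + v * sinh a"
    by (simp add: cosh_field_def sinh_field_def field_simps)
  finally show ?thesis
    by (simp add: field_simps)
qed

context prob_space
begin

text \<open>What is known before \<open>g\<close> is revealed is uncorrelated with \<open>g\<close>.\<close>

lemma expectation_adapted_mult_eq_0:
  assumes F: "subalgebra M F"
    and f: "f \<in> borel_measurable F" and g: "g \<in> borel_measurable M"
    and fg: "integrable M (\<lambda>\<omega>. f \<omega> * g \<omega>)"
    and zero: "AE \<omega> in M. real_cond_exp M F g \<omega> = 0"
  shows "expectation (\<lambda>\<omega>. f \<omega> * g \<omega>) = 0"
proof -
  interpret finite_measure_subalgebra M F
    by unfold_locales (rule F)
  have [measurable]: "f \<in> borel_measurable M"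
    by (rule measurable_from_subalg[OF F f])
  have "expectation (\<lambda>\<omega>. f \<omega> * g \<omega>) = expectation (\<lambda>\<omega>. f \<omega> * real_cond_exp M F g \<omega>)"
    by (rule real_cond_exp_intg(2)[OF fg f g, symmetric])
  also have "\<dots> = expectation (\<lambda>_. 0)"
    using zero by (intro integral_cong_AE) auto
  finally show ?thesis
    by simp
qed

text \<open>
  Peeling off the last difference multiplies the moment generating function by at most
  \<open>cosh (l c) \<le> exp (l\<^sup>2 c\<^sup>2 / 2)\<close>: the part of the chord bound that is linear in the difference
  vanishes, because the earlier differences are known to \<open>F (Suc N)\<close>.
\<close>

lemma martingale_difference_mgf_le:
  fixes D :: "nat \<Rightarrow> 'a \<Rightarrow> real"
  assumes "\<And>k. k \<in> {1..N} \<Longrightarrow> subalgebra M (F k)"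
    and "\<And>k. k \<in> {1..N} \<Longrightarrow> D k \<in> borel_measurable M"
    and "\<And>i k. k \<in> {1..N} \<Longrightarrow> i \<in> {1..<k} \<Longrightarrow> D i \<in> borel_measurable (F k)"
    and "\<And>k. k \<in> {1..N} \<Longrightarrow> AE \<omega> in M. real_cond_exp M (F k) (D k) \<omega> = 0"
    and "\<And>k. k \<in> {1..N} \<Longrightarrow> AE \<omega> in M. \<bar>D k \<omega>\<bar> \<le> c k"
  shows "integrable M (\<lambda>\<omega>. exp (l * (\<Sum>k=1..N. D k \<omega>)))"
    and "expectation (\<lambda>\<omega>. exp (l * (\<Sum>k=1..N. D k \<omega>))) \<le> exp (l\<^sup>2 * (\<Sum>k=1..N. (c k)\<^sup>2) / 2)"
proof -
  have "integrable M (\<lambda>\<omega>. exp (l * (\<Sum>k=1..N. D k \<omega>))) \<and>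
    expectation (\<lambda>\<omega>. exp (l * (\<Sum>k=1..N. D k \<omega>))) \<le> exp (l\<^sup>2 * (\<Sum>k=1..N. (c k)\<^sup>2) / 2)"
    using assms
  proof (induction N)
    case 0
    then show ?case by simp
  next
    case (Suc N)
    define E where "E = (\<lambda>\<omega>. exp (l * (\<Sum>k=1..N. D k \<omega>)))"
    define C where "C = c (Suc N)"
    define D' where "D' = D (Suc N)"
    have intE: "integrable M E"
      and IH: "expectation E \<le> exp (l\<^sup>2 * (\<Sum>k=1..N. (c k)\<^sup>2) / 2)"
      using Suc.IH Suc.prems unfolding E_def by auto
    have sub: "subalgebra M (F (Suc N))"
      by (rule Suc.prems(1)) simp
    have [measurable]: "(\<lambda>\<omega>. \<Sum>k=1..N. D k \<omega>) \<in> borel_measurable (F (Suc N))"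
      using Suc.prems(3)[of "Suc N"] by (intro borel_measurable_sum) auto
    have EF: "E \<in> borel_measurable (F (Suc N))"
      unfolding E_def by measurable
    have [measurable]: "D' \<in> borel_measurable M"
      unfolding D'_def by (rule Suc.prems(2)) simp
    have [measurable]: "E \<in> borel_measurable M"
      using intE by auto
    have bound: "AE \<omega> in M. \<bar>D' \<omega>\<bar> \<le> C"
      unfolding D'_def C_def by (rule Suc.prems(5)) simp
    have intED: "integrable M (\<lambda>\<omega>. E \<omega> * D' \<omega>)"
    proof (rule Bochner_Integration.integrable_bound)
      show "integrable M (\<lambda>\<omega>. E \<omega> * C)"
        using intE by simp
      show "AE \<omega> in M. norm (E \<omega> * D' \<omega>) \<le> norm (E \<omega> * C)"
        using bound by eventually_elim (auto simp: abs_mult E_def intro!: mult_left_mono)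
    qed simp
    have zero: "expectation (\<lambda>\<omega>. E \<omega> * D' \<omega>) = 0"
      by (rule expectation_adapted_mult_eq_0[OF sub EF _ intED])
        (use Suc.prems(2,4)[of "Suc N"] in \<open>simp_all add: D'_def\<close>)
    have split: "exp (l * (\<Sum>k=1..Suc N. D k \<omega>)) = E \<omega> * exp (l * D' \<omega>)" for \<omega>
      by (simp add: E_def D'_def ring_distribs exp_add)
    \<comment> \<open>For \<open>C = 0\<close> the quotient is the default value \<open>0\<close>, which is right since then \<open>D' = 0\<close>.\<close>
    have chord: "AE \<omega> in M. E \<omega> * exp (l * D' \<omega>)
        \<le> cosh (l * C) * E \<omega> + (sinh (l * C) / C) * (E \<omega> * D' \<omega>)"
      using bound
    proof eventually_elim
      case (elim \<omega>)
      have "exp (l * C * (D' \<omega> / C)) \<le> cosh (l * C) + D' \<omega> / C * sinh (l * C)"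
        using elim by (intro exp_mult_le_chord) (auto simp: divide_le_eq_1)
      moreover have "l * C * (D' \<omega> / C) = l * D' \<omega>"
        using elim by (cases "C = 0") auto
      ultimately have "E \<omega> * exp (l * D' \<omega>)
          \<le> E \<omega> * (cosh (l * C) + D' \<omega> / C * sinh (l * C))"
        by (intro mult_left_mono) (auto simp: E_def)
      then show ?case
        by (simp add: algebra_simps)
    qed
    have intR: "integrable M (\<lambda>\<omega>. cosh (l * C) * E \<omega> + (sinh (l * C) / C) * (E \<omega> * D' \<omega>))"
      using intE intED by (intro Bochner_Integration.integrable_add integrable_mult_right) auto
    have int: "integrable M (\<lambda>\<omega>. E \<omega> * exp (l * D' \<omega>))"
    proof (rule Bochner_Integration.integrable_bound[OF intR])
      show "AE \<omega> in M. norm (E \<omega> * exp (l * D' \<omega>))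
          \<le> norm (cosh (l * C) * E \<omega> + (sinh (l * C) / C) * (E \<omega> * D' \<omega>))"
        using chord by eventually_elim (auto simp: E_def)
    qed simp
    have "expectation (\<lambda>\<omega>. E \<omega> * exp (l * D' \<omega>))
        \<le> expectation (\<lambda>\<omega>. cosh (l * C) * E \<omega> + (sinh (l * C) / C) * (E \<omega> * D' \<omega>))"
      by (rule integral_mono_AE[OF int intR chord])
    also have "\<dots> = cosh (l * C) * expectation E"
      using intE intED zero by (subst Bochner_Integration.integral_add) auto
    also have "\<dots> \<le> exp ((l * C)\<^sup>2 / 2) * exp (l\<^sup>2 * (\<Sum>k=1..N. (c k)\<^sup>2) / 2)"
      using IH by (intro mult_mono cosh_le_exp_half_square) (auto simp: E_def)
    also have "\<dots> = exp (l\<^sup>2 * (\<Sum>k=1..Suc N. (c k)\<^sup>2) / 2)"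
      by (simp add: C_def field_simps flip: exp_add)
    finally show ?case
      using int by (simp only: split)
  qed
  then show "integrable M (\<lambda>\<omega>. exp (l * (\<Sum>k=1..N. D k \<omega>)))"
    and "expectation (\<lambda>\<omega>. exp (l * (\<Sum>k=1..N. D k \<omega>))) \<le> exp (l\<^sup>2 * (\<Sum>k=1..N. (c k)\<^sup>2) / 2)"
    by auto
qed

text \<open>
  The bound \<open>V\<close> is kept apart from the sum of the squares, which may be \<open>0\<close>, so that \<open>t / V\<close> is a
  legitimate Chernoff parameter and a simpler upper bound can be inserted.
\<close>

theorem azuma_hoeffding:
  fixes D :: "nat \<Rightarrow> 'a \<Rightarrow> real"
  assumes "\<And>k. k \<in> {1..N} \<Longrightarrow> subalgebra M (F k)"
    and meas: "\<And>k. k \<in> {1..N} \<Longrightarrow> D k \<in> borel_measurable M"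
    and "\<And>i k. k \<in> {1..N} \<Longrightarrow> i \<in> {1..<k} \<Longrightarrow> D i \<in> borel_measurable (F k)"
    and "\<And>k. k \<in> {1..N} \<Longrightarrow> AE \<omega> in M. real_cond_exp M (F k) (D k) \<omega> = 0"
    and "\<And>k. k \<in> {1..N} \<Longrightarrow> AE \<omega> in M. \<bar>D k \<omega>\<bar> \<le> c k"
    and V: "(\<Sum>k=1..N. (c k)\<^sup>2) \<le> V" "0 < V" and t: "0 < t"
  shows "prob {\<omega> \<in> space M. t \<le> \<bar>\<Sum>k=1..N. D k \<omega>\<bar>} \<le> 2 * exp (- t\<^sup>2 / (2 * V))"
proof -
  define S where "S = (\<lambda>\<omega>. \<Sum>k=1..N. D k \<omega>)"
  have [measurable]: "S \<in> borel_measurable M"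
    unfolding S_def using meas by (intro borel_measurable_sum) auto
  have int: "integrable M (\<lambda>\<omega>. exp (l * S \<omega>))"
    and mgf: "expectation (\<lambda>\<omega>. exp (l * S \<omega>)) \<le> exp (l\<^sup>2 * V / 2)" for l
  proof -
    show "integrable M (\<lambda>\<omega>. exp (l * S \<omega>))"
      unfolding S_def by (rule martingale_difference_mgf_le(1)[OF assms(1-5)])
    have "expectation (\<lambda>\<omega>. exp (l * S \<omega>)) \<le> exp (l\<^sup>2 * (\<Sum>k=1..N. (c k)\<^sup>2) / 2)"
      unfolding S_def by (rule martingale_difference_mgf_le(2)[OF assms(1-5)])
    also have "\<dots> \<le> exp (l\<^sup>2 * V / 2)"
      using V by (auto intro!: mult_left_mono)
    finally show "expectation (\<lambda>\<omega>. exp (l * S \<omega>)) \<le> exp (l\<^sup>2 * V / 2)" .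
  qed
  \<comment> \<open>\<open>s = t / V\<close> minimises the exponent \<open>s\<^sup>2 V / 2 - s t\<close> of the Chernoff bound.\<close>
  define s where "s = t / V"
  have s: "0 < s" "exp (- s * t) * exp (s\<^sup>2 * V / 2) = exp (- t\<^sup>2 / (2 * V))"
    using t V by (simp_all add: s_def field_simps power2_eq_square flip: exp_add)
  have tail: "prob {\<omega> \<in> space M. t \<le> r * S \<omega>} \<le> exp (- t\<^sup>2 / (2 * V))" if "r\<^sup>2 = 1" for r
  proof -
    have "prob {\<omega> \<in> space M. t \<le> r * S \<omega>}
        \<le> exp (- s * t) * (\<integral>\<omega>\<in>space M. exp (s * (r * S \<omega>)) \<partial>M)"
      using int[of "s * r"] s(1)
      by (intro Chernoff_ineq_ge) (auto simp: set_integrable_def mult.assoc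
          intro: integrable_mult_indicator[of "space M" M "\<lambda>\<omega>. exp (s * (r * S \<omega>))", simplified])
    also have "(\<integral>\<omega>\<in>space M. exp (s * (r * S \<omega>)) \<partial>M) = expectation (\<lambda>\<omega>. exp ((s * r) * S \<omega>))"
      using int[of "s * r"] by (simp add: set_integral_space mult.assoc)
    also have "exp (- s * t) * \<dots> \<le> exp (- s * t) * exp ((s * r)\<^sup>2 * V / 2)"
      using mgf by (intro mult_left_mono) auto
    also have "\<dots> = exp (- t\<^sup>2 / (2 * V))"
      using s(2) that by (simp add: power_mult_distrib)
    finally show ?thesis .
  qed
  have "prob {\<omega> \<in> space M. t \<le> \<bar>S \<omega>\<bar>}
      \<le> prob ({\<omega> \<in> space M. t \<le> 1 * S \<omega>} \<union> {\<omega> \<in> space M. t \<le> (-1) * S \<omega>})"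
    by (intro finite_measure_mono) auto
  also have "\<dots> \<le> prob {\<omega> \<in> space M. t \<le> 1 * S \<omega>} + prob {\<omega> \<in> space M. t \<le> (-1) * S \<omega>}"
    by (intro measure_Un_le) auto
  also have "\<dots> \<le> 2 * exp (- t\<^sup>2 / (2 * V))"
    using tail[of 1] tail[of "-1"] by simp
  finally show ?thesis
    by (simp add: S_def)
qed

end

section \<open>The rounding error as a martingale\<close>

text \<open>
  The quantity to which roundoff number \<open>i\<close> is applied. An odd \<open>i\<close> rounds the running sum, an even \<open>i\<close>
  rounds the product that is about to be added.
\<close>

definition roundoff_weight :: "(nat \<Rightarrow> real) \<Rightarrow> (nat \<Rightarrow> real) \<Rightarrow> (nat \<Rightarrow> real) \<Rightarrow> nat \<Rightarrow> real" where
  "roundoff_weight x y d i =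
    (if odd i then partial_sum x y d i else x (i div 2 + 1) * y (i div 2 + 1))"

text \<open>
  Exact and rounded recursion perform the same additions, so that in each step their difference
  changes only by the new local error, in which the rounded quantity appears.
\<close>

lemma partial_sum_error:
  "partial_sum x y d (Suc j) - partial_sum x y (\<lambda>_. 0) (Suc j)
    = (\<Sum>i=1..j. roundoff_weight x y d i * d i)"
proof (induction j)
  case 0
  then show ?case by simp
next
  case (Suc j)
  have "(j + 3) div 2 = Suc j div 2 + 1"
    by simp
  then show ?case
    using Suc.IH by (auto simp: roundoff_weight_def algebra_simps)
qed

lemma partial_sum_exact: "partial_sum x y (\<lambda>_. 0) (2 * n) = inner_prod n x y"
proof (induction n)
  case 0
  then show ?case by (simp add: inner_prod_def)
next
  case (Suc n)
  show ?case
  proof (cases "n = 0")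
    case True
    then show ?thesis
      by (simp add: inner_prod_def numeral_2_eq_2)
  next
    case False
    then show ?thesis
      using Suc.IH partial_sum_even[of "Suc n" x y "\<lambda>_. 0"] partial_sum_odd[of "Suc n" x y "\<lambda>_. 0"]
      by (simp add: inner_prod_def)
  qed
qed

lemma fl_inner_prod_error:
  assumes "n > 0"
  shows "fl_inner_prod n x y d - inner_prod n x y
    = (\<Sum>i=1..2 * n - 1. roundoff_weight x y d i * d i)"
  using partial_sum_error[of x y d "2 * n - 1"] assms
  by (simp add: fl_inner_prod_def partial_sum_exact)

lemma abs_inner_prod_Suc:
  "inner_prod (Suc n) (abs_vec x) (abs_vec y)
    = inner_prod n (abs_vec x) (abs_vec y) + \<bar>x (Suc n) * y (Suc n)\<bar>"
  by (simp add: inner_prod_def abs_vec_def abs_mult)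

lemma abs_inner_prod_nonneg: "0 \<le> inner_prod n (abs_vec x) (abs_vec y)"
  by (auto simp: inner_prod_def abs_vec_def intro!: sum_nonneg)

lemma abs_inner_prod_pos:
  assumes "inner_prod n x y \<noteq> 0"
  shows "0 < inner_prod n (abs_vec x) (abs_vec y)"
proof -
  have "\<bar>inner_prod n x y\<bar> \<le> inner_prod n (abs_vec x) (abs_vec y)"
    using sum_abs[of "\<lambda>k. x k * y k" "{1..n}"] by (simp add: inner_prod_def abs_vec_def abs_mult)
  then show ?thesis
    using assms by linarith
qed

text \<open>
  A factor \<open>1 + u\<close> is needed only once per component and not once per roundoff, because the rounding of a
  product reaches that product alone and not the terms accumulated before it.
\<close>

lemma abs_partial_sum_le:
  assumes "0 \<le> u" and "\<And>i. i \<in> {1..2 * k} \<Longrightarrow> \<bar>d i\<bar> \<le> u"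
  shows "\<bar>partial_sum x y d (2 * k + 1)\<bar>
    \<le> inner_prod (k + 1) (abs_vec x) (abs_vec y) * (1 + u) ^ k"
  using assms(2)
proof (induction k)
  case 0
  then show ?case by (simp add: abs_inner_prod_Suc inner_prod_def abs_vec_def abs_mult)
next
  case (Suc k)
  define T where "T = inner_prod (k + 1) (abs_vec x) (abs_vec y)"
  define a where "a = x (k + 2) * y (k + 2)"
  have IH: "\<bar>partial_sum x y d (2 * k + 1)\<bar> \<le> T * (1 + u) ^ k"
    unfolding T_def using Suc.prems by (intro Suc.IH) auto
  have d: "\<bar>1 + d (2 * k + 1)\<bar> \<le> 1 + u" "\<bar>1 + d (2 * k + 2)\<bar> \<le> 1 + u"
    using Suc.prems[of "2 * k + 1"] Suc.prems[of "2 * k + 2"] by auto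
  have "\<bar>partial_sum x y d (2 * Suc k + 1)\<bar>
      = \<bar>partial_sum x y d (2 * k + 1) * (1 + d (2 * k + 1)) + a * (1 + d (2 * k + 2))\<bar>"
    by (simp add: a_def)
  also have "\<dots> \<le> \<bar>partial_sum x y d (2 * k + 1)\<bar> * \<bar>1 + d (2 * k + 1)\<bar> + \<bar>a\<bar> * \<bar>1 + d (2 * k + 2)\<bar>"
    by (metis abs_mult abs_triangle_ineq)
  also have "\<dots> \<le> (T * (1 + u) ^ k) * (1 + u) + \<bar>a\<bar> * (1 + u)"
    using IH d by (intro add_mono mult_mono mult_left_mono) auto
  also have "\<dots> \<le> (T * (1 + u) ^ k) * (1 + u) + \<bar>a\<bar> * (1 + u) ^ Suc k"
    using assms(1) self_le_power[of "1 + u" "Suc k"] by (intro add_left_mono mult_left_mono) auto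
  also have "\<dots> = inner_prod (Suc k + 1) (abs_vec x) (abs_vec y) * (1 + u) ^ Suc k"
    by (simp add: T_def a_def abs_inner_prod_Suc algebra_simps)
  finally show ?case .
qed

definition weight_bound :: "(nat \<Rightarrow> real) \<Rightarrow> (nat \<Rightarrow> real) \<Rightarrow> real \<Rightarrow> nat \<Rightarrow> real" where
  "weight_bound x y u i =
    (if odd i then inner_prod (i div 2 + 1) (abs_vec x) (abs_vec y) * (1 + u) ^ (i div 2)
     else \<bar>x (i div 2 + 1) * y (i div 2 + 1)\<bar>)"

lemma abs_roundoff_weight_le:
  assumes "0 \<le> u" and "\<And>j. j \<in> {1..<i} \<Longrightarrow> \<bar>d j\<bar> \<le> u"
  shows "\<bar>roundoff_weight x y d i\<bar> \<le> weight_bound x y u i"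
proof (cases "odd i")
  case True
  then obtain k where "i = 2 * k + 1"
    by (elim oddE)
  then show ?thesis
    using abs_partial_sum_le[of u k d x y] assms by (simp add: roundoff_weight_def weight_bound_def)
qed (simp add: roundoff_weight_def weight_bound_def)

text \<open>
  The right-hand side is what the odd terms give when each running sum of absolute values is replaced
  by the full one. This replacement is generous enough to pay for the even terms too: with \<open>T\<close> the old
  and \<open>T + a\<close> the new sum of absolute values, \<open>T\<^sup>2 + a\<^sup>2 \<le> (T + a)\<^sup>2\<close>, so that the square of a product
  is absorbed by the growth of the sum.
\<close>

lemma sum_weight_bound_squared_le:
  assumes "0 \<le> u"
  shows "(\<Sum>i=1..2 * m + 1. (weight_bound x y u i)\<^sup>2)
    \<le> (inner_prod (m + 1) (abs_vec x) (abs_vec y))\<^sup>2 * (\<Sum>k\<le>m. (1 + u) ^ (2 * k))"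
proof (induction m)
  case 0
  then show ?case by (simp add: weight_bound_def)
next
  case (Suc m)
  define T where "T = inner_prod (m + 1) (abs_vec x) (abs_vec y)"
  define a where "a = \<bar>x (m + 2) * y (m + 2)\<bar>"
  define G where "G = (\<Sum>k\<le>m. (1 + u) ^ (2 * k))"
  have Ta: "inner_prod (m + 2) (abs_vec x) (abs_vec y) = T + a"
    using abs_inner_prod_Suc[of "m + 1" x y] by (simp add: T_def a_def)
  have nonneg: "0 \<le> T" "0 \<le> a"
    by (simp_all add: T_def a_def abs_inner_prod_nonneg)
  have "(1 + u) ^ (2 * 0) \<le> G"
    unfolding G_def using assms by (intro member_le_sum) auto
  then have G: "1 \<le> G"
    by simp
  have IH: "(\<Sum>i=1..2 * m + 1. (weight_bound x y u i)\<^sup>2) \<le> T\<^sup>2 * G"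
    unfolding T_def G_def by (rule Suc.IH)
  have "(\<Sum>i=1..2 * Suc m + 1. (weight_bound x y u i)\<^sup>2)
      = (\<Sum>i=1..2 * m + 1. (weight_bound x y u i)\<^sup>2) + a\<^sup>2 + ((T + a) * (1 + u) ^ Suc m)\<^sup>2"
  proof -
    have "weight_bound x y u (2 * m + 2) = a"
      by (simp add: weight_bound_def a_def)
    moreover have "weight_bound x y u (2 * m + 3) = (T + a) * (1 + u) ^ Suc m"
      using Ta by (simp add: weight_bound_def)
    moreover have "{1..2 * Suc m + 1} = insert (2 * m + 3) (insert (2 * m + 2) {1..2 * m + 1})"
      by auto
    ultimately show ?thesis
      by simp
  qed
  also have "\<dots> \<le> T\<^sup>2 * G + a\<^sup>2 * G + ((T + a) * (1 + u) ^ Suc m)\<^sup>2"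
    using IH G mult_left_mono[of 1 G "a\<^sup>2"] by simp
  also have "\<dots> \<le> (T + a)\<^sup>2 * G + ((T + a) * (1 + u) ^ Suc m)\<^sup>2"
  proof -
    have "T\<^sup>2 + a\<^sup>2 \<le> (T + a)\<^sup>2"
      using nonneg by (simp add: power2_sum)
    then have "(T\<^sup>2 + a\<^sup>2) * G \<le> (T + a)\<^sup>2 * G"
      using G by (intro mult_right_mono) auto
    then show ?thesis
      by (simp add: algebra_simps)
  qed
  also have "\<dots> = (T + a)\<^sup>2 * (\<Sum>k\<le>Suc m. (1 + u) ^ (2 * k))"
  proof -
    have "((1 + u) ^ Suc m)\<^sup>2 = (1 + u) ^ (2 * Suc m)"
      by (simp only: power_even_eq)
    then show ?thesis
      by (simp only: G_def power_mult_distrib sum.atMost_Suc distrib_left)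
  qed
  finally show ?case
    using Ta by simp
qed

text \<open>
  The geometric sum has the exact value \<open>gamma_factor u (2 n) / (u (u + 2))\<close>; the \<open>2\<close> in the
  claimed bound comes from \<open>u + 2 \<ge> 2\<close>.
\<close>

lemma sum_weight_bound_squared_le_gamma:
  assumes "0 < u" and "n > 0"
  shows "(\<Sum>i=1..2 * n - 1. (u * weight_bound x y u i)\<^sup>2)
    \<le> (inner_prod n (abs_vec x) (abs_vec y))\<^sup>2 * (u * gamma_factor u (2 * n) / 2)"
proof -
  obtain m where m: "n = Suc m"
    using assms(2) gr0_conv_Suc by blast
  define G where "G = (\<Sum>k\<le>m. (1 + u) ^ (2 * k))"
  have "gamma_factor u (2 * n) = ((1 + u)\<^sup>2) ^ Suc m - 1"
    by (simp only: gamma_factor_def m power_mult)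
  also have "\<dots> = ((1 + u)\<^sup>2 - 1) * (\<Sum>k\<le>m. ((1 + u)\<^sup>2) ^ k)"
    using power_diff_1_eq[of "(1 + u)\<^sup>2" "Suc m"] by (simp only: lessThan_Suc_atMost)
  also have "\<dots> = u * (u + 2) * G"
    by (simp only: G_def power_mult) (simp add: power2_eq_square algebra_simps)
  finally have geometric: "u * (u + 2) * G = gamma_factor u (2 * n)" ..
  have "0 \<le> G"
    unfolding G_def using assms(1) by (intro sum_nonneg) auto
  then have "u * u * (u * G) \<ge> 0"
    using assms(1) by simp
  then have G: "u\<^sup>2 * G \<le> u * gamma_factor u (2 * n) / 2"
    unfolding geometric[symmetric] by (simp add: power2_eq_square field_simps)
  have "(\<Sum>i=1..2 * n - 1. (u * weight_bound x y u i)\<^sup>2)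
      = u\<^sup>2 * (\<Sum>i=1..2 * m + 1. (weight_bound x y u i)\<^sup>2)"
    by (simp add: m power_mult_distrib distrib_left flip: sum_distrib_left)
  also have "\<dots> \<le> u\<^sup>2 * ((inner_prod n (abs_vec x) (abs_vec y))\<^sup>2 * G)"
    using sum_weight_bound_squared_le[of u x y m] assms(1)
    by (intro mult_left_mono) (auto simp: G_def m)
  also have "\<dots> \<le> (inner_prod n (abs_vec x) (abs_vec y))\<^sup>2 * (u * gamma_factor u (2 * n) / 2)"
    using mult_left_mono[OF G, of "(inner_prod n (abs_vec x) (abs_vec y))\<^sup>2"]
    by (simp add: algebra_simps)
  finally show ?thesis .
qed

section \<open>Measurability with respect to the roundoff history\<close>

lemma space_roundoff_history [simp]: "space (roundoff_history M \<delta> k) = space M"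
  unfolding roundoff_history_def by (rule space_measure_of) auto

lemma sets_roundoff_history:
  "sets (roundoff_history M \<delta> k)
    = sigma_sets (space M) (\<Union>i\<in>{1..<k}. {\<delta> i -` A \<inter> space M | A. A \<in> sets borel})"
  unfolding roundoff_history_def by (rule sets_measure_of) auto

lemma measurable_roundoff_history:
  assumes "i \<in> {1..<k}"
  shows "\<delta> i \<in> borel_measurable (roundoff_history M \<delta> k)"
proof (rule measurableI)
  fix A :: "real set"
  assume "A \<in> sets borel"
  then have "\<delta> i -` A \<inter> space M \<in> sets (roundoff_history M \<delta> k)"
    using assms unfolding sets_roundoff_history by (intro sigma_sets.Basic) blast
  then show "\<delta> i -` A \<inter> space (roundoff_history M \<delta> k) \<in> sets (roundoff_history M \<delta> k)"
    by simp
qed simp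

lemma subalgebra_roundoff_history:
  assumes "\<And>i. i \<in> {1..<k} \<Longrightarrow> \<delta> i \<in> borel_measurable M"
  shows "subalgebra M (roundoff_history M \<delta> k)"
proof -
  have "(\<Union>i\<in>{1..<k}. {\<delta> i -` A \<inter> space M | A. A \<in> sets borel}) \<subseteq> sets M"
    using assms by (auto intro: measurable_sets)
  then show ?thesis
    unfolding subalgebra_def sets_roundoff_history by (simp add: sets.sigma_sets_subset)
qed

lemma measurable_partial_sum:
  assumes "\<And>i. i \<in> {1..<k} \<Longrightarrow> \<delta> i \<in> borel_measurable N"
  shows "(\<lambda>\<omega>. partial_sum x y (\<lambda>i. \<delta> i \<omega>) k) \<in> borel_measurable N"
  using assms
proof (induction k rule: induct_nat_012)
  case (ge2 m)
  have [measurable]: "\<delta> (Suc m) \<in> borel_measurable N"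
    "(\<lambda>\<omega>. partial_sum x y (\<lambda>i. \<delta> i \<omega>) (Suc m)) \<in> borel_measurable N"
    using ge2 by auto
  show ?case
    by (cases "even m") simp_all
qed simp_all

lemma measurable_roundoff_weight:
  assumes "\<And>j. j \<in> {1..<i} \<Longrightarrow> \<delta> j \<in> borel_measurable N"
  shows "(\<lambda>\<omega>. roundoff_weight x y (\<lambda>j. \<delta> j \<omega>) i) \<in> borel_measurable N"
  using measurable_partial_sum[of i \<delta> N x y] assms
  by (cases "odd i") (simp_all add: roundoff_weight_def)

section \<open>The probabilistic error bound\<close>

theorem corollary4p9:
  fixes M :: "'a measure"
    and n :: nat
    and x y :: "nat \<Rightarrow> real"
    and u p :: real
    and \<delta> :: "nat \<Rightarrow> 'a \<Rightarrow> real"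
  assumes "prob_space M"
    and "inner_prod n x y \<noteq> 0"
    and "0 < u" and "u < 1"
    and "\<And>k. k \<in> {1..2 * n - 1} \<Longrightarrow> \<delta> k \<in> borel_measurable M"
    and "\<And>k. k \<in> {1..2 * n - 1} \<Longrightarrow> prob_space.expectation M (\<delta> k) = 0"
    and "\<And>k. k \<in> {1..2 * n - 1} \<Longrightarrow> AE \<omega> in M. \<bar>\<delta> k \<omega>\<bar> \<le> u"
    and "mean_independent M (2 * n - 1) \<delta>"
    and "0 < p" and "p < 1"
  shows "prob_space.prob M
      {\<omega> \<in> space M.
        \<bar>(fl_inner_prod n x y (\<lambda>k. \<delta> k \<omega>) - inner_prod n x y) / inner_prod n x y\<bar>
          \<le> inner_prod n (abs_vec x) (abs_vec y) / \<bar>inner_prod n x y\<bar>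
              * sqrt (2 * ln (2 / p)) * sqrt (u * gamma_factor u (2 * n) / 2)}
    \<ge> 1 - p"
proof -
  interpret prob_space M by fact
  note meas = assms(5)
  define N where "N = 2 * n - 1"
  define T where "T = inner_prod n (abs_vec x) (abs_vec y)"
  define V where "V = T\<^sup>2 * (u * gamma_factor u (2 * n) / 2)"
  define t where "t = sqrt (2 * ln (2 / p)) * sqrt V"
  define D where "D = (\<lambda>k \<omega>. roundoff_weight x y (\<lambda>i. \<delta> i \<omega>) k * \<delta> k \<omega>)"
  define F where "F = roundoff_history M \<delta>"
  have n: "n > 0"
    using assms(2) by (cases n) (auto simp: inner_prod_def)
  have T: "0 < T"
    unfolding T_def by (rule abs_inner_prod_pos) fact
  have gamma: "0 < gamma_factor u (2 * n)"
    using n assms(3) one_less_power[of "1 + u" "2 * n"] by (simp add: gamma_factor_def)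
  have V: "0 < V"
    using T gamma assms(3) by (simp add: V_def)
  have ln: "0 < ln (2 / p)"
    using assms(9,10) by simp
  have t: "0 < t" and t2: "t\<^sup>2 = 2 * ln (2 / p) * V"
    using V ln by (simp_all add: t_def power_mult_distrib)
  have subF: "subalgebra M (F k)" if "k \<in> {1..N}" for k
    unfolding F_def using that meas by (intro subalgebra_roundoff_history) (auto simp: N_def)
  have weight_F: "(\<lambda>\<omega>. roundoff_weight x y (\<lambda>i. \<delta> i \<omega>) k) \<in> borel_measurable (F j)"
    if "k \<le> j" for j k
    unfolding F_def using that by (intro measurable_roundoff_weight measurable_roundoff_history) auto
  have D_meas: "D k \<in> borel_measurable M" if "k \<in> {1..N}" for k
    unfolding D_def using that meas
    by (intro borel_measurable_times measurable_from_subalg[OF subF weight_F]) (auto simp: N_def)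
  have D_F: "D i \<in> borel_measurable (F k)" if "k \<in> {1..N}" "i \<in> {1..<k}" for i k
  proof -
    have "\<delta> i \<in> borel_measurable (F k)"
      unfolding F_def using that by (intro measurable_roundoff_history) auto
    then show ?thesis
      unfolding D_def using that by (intro borel_measurable_times weight_F) auto
  qed
  have bounds: "AE \<omega> in M. \<forall>k\<in>{1..N}. \<bar>\<delta> k \<omega>\<bar> \<le> u"
    using assms(7) by (intro AE_finite_allI) (auto simp: N_def)
  have D_bound: "AE \<omega> in M. \<bar>D k \<omega>\<bar> \<le> u * weight_bound x y u k" if "k \<in> {1..N}" for k
    using bounds
  proof eventually_elim
    case (elim \<omega>)
    have "\<bar>roundoff_weight x y (\<lambda>i. \<delta> i \<omega>) k\<bar> \<le> weight_bound x y u k"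
      using elim that assms(3) by (intro abs_roundoff_weight_le) auto
    moreover have "\<bar>\<delta> k \<omega>\<bar> \<le> u"
      using elim that by blast
    ultimately have "\<bar>\<delta> k \<omega>\<bar> * \<bar>roundoff_weight x y (\<lambda>i. \<delta> i \<omega>) k\<bar> \<le> u * weight_bound x y u k"
      using assms(3) by (intro mult_mono) auto
    then show ?case
      by (simp add: D_def abs_mult mult.commute)
  qed
  have D_mean: "AE \<omega> in M. real_cond_exp M (F k) (D k) \<omega> = 0" if k: "k \<in> {1..N}" for k
  proof -
    interpret finite_measure_subalgebra M "F k"
      by unfold_locales (rule subF[OF k])
    have int: "integrable M (\<lambda>\<omega>. roundoff_weight x y (\<lambda>i. \<delta> i \<omega>) k * \<delta> k \<omega>)"
      using D_bound[OF k] D_meas[OF k] unfolding D_def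
      by (intro integrable_const_bound[where B = "u * weight_bound x y u k"]) auto
    have "AE \<omega> in M. real_cond_exp M (F k) (D k) \<omega>
        = roundoff_weight x y (\<lambda>i. \<delta> i \<omega>) k * real_cond_exp M (F k) (\<delta> k) \<omega>"
      unfolding D_def using k meas
      by (intro real_cond_exp_mult[OF weight_F _ int]) (auto simp: N_def)
    moreover have "AE \<omega> in M. real_cond_exp M (F k) (\<delta> k) \<omega> = 0"
      using assms(6)[of k] assms(8) k unfolding mean_independent_def F_def N_def by force
    ultimately show ?thesis
      by eventually_elim simp
  qed
  have [measurable]: "(\<lambda>\<omega>. \<Sum>k=1..N. D k \<omega>) \<in> borel_measurable M"
    using D_meas by (intro borel_measurable_sum) auto
  \<comment> \<open>The level \<open>t\<close> is chosen so that the Azuma--Hoeffding tail is exactly \<open>p\<close>.\<close>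
  have "prob {\<omega> \<in> space M. t \<le> \<bar>\<Sum>k=1..N. D k \<omega>\<bar>} \<le> 2 * exp (- t\<^sup>2 / (2 * V))"
  proof (rule azuma_hoeffding[OF subF D_meas D_F D_mean D_bound _ V t])
    show "(\<Sum>k=1..N. (u * weight_bound x y u k)\<^sup>2) \<le> V"
      unfolding V_def T_def N_def by (rule sum_weight_bound_squared_le_gamma) fact+
  qed
  also have "\<dots> = p"
    using t2 V assms(9) by (simp add: exp_minus)
  finally have "1 - p \<le> 1 - prob {\<omega> \<in> space M. t \<le> \<bar>\<Sum>k=1..N. D k \<omega>\<bar>}"
    by simp
  also have "\<dots> = prob (space M - {\<omega> \<in> space M. t \<le> \<bar>\<Sum>k=1..N. D k \<omega>\<bar>})"
    by (rule prob_compl[symmetric]) measurable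
  also have "\<dots> \<le> prob {\<omega> \<in> space M. \<bar>\<Sum>k=1..N. D k \<omega>\<bar> \<le> t}"
  proof (rule finite_measure_mono)
    show "{\<omega> \<in> space M. \<bar>\<Sum>k=1..N. D k \<omega>\<bar> \<le> t} \<in> events"
      by measurable
  qed auto
  also have "{\<omega> \<in> space M. \<bar>\<Sum>k=1..N. D k \<omega>\<bar> \<le> t} =
      {\<omega> \<in> space M.
        \<bar>(fl_inner_prod n x y (\<lambda>k. \<delta> k \<omega>) - inner_prod n x y) / inner_prod n x y\<bar>
          \<le> T / \<bar>inner_prod n x y\<bar>
              * sqrt (2 * ln (2 / p)) * sqrt (u * gamma_factor u (2 * n) / 2)}"
  proof -
    have t_eq: "T / \<bar>inner_prod n x y\<bar> * sqrt (2 * ln (2 / p)) * sqrt (u * gamma_factor u (2 * n) / 2)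
        = t / \<bar>inner_prod n x y\<bar>"
      using T by (simp only: t_def V_def real_sqrt_mult real_sqrt_abs) simp
    have "(\<Sum>k=1..N. D k \<omega>) = fl_inner_prod n x y (\<lambda>k. \<delta> k \<omega>) - inner_prod n x y" for \<omega>
      unfolding D_def N_def using fl_inner_prod_error[OF n] by simp
    then show ?thesis
      unfolding t_eq using assms(2) by (simp add: abs_divide divide_le_cancel)
  qed
  finally show ?thesis
    unfolding T_def .
qed

end
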